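(* Suppose $t_0=0$, let $\tau>0$, let $V,W:\mathbb R^n\times\mathbb R^n\times[0,\infty)\to\mathbb R^m$ be two vector-valued functions, and let $\kappa\in\mathcal K_1(\tau)$ be the inverse function of $\mu\in\mathcal M_1(\tau)$. Let $u=f(\dot q,q)$ be an infinite-time controller (ITC) for the system $M(q)\ddot q+C(\dot q,q)\dot q+g(q)=u$, and let $u=h(\dot q,q,t)$ be the corresponding prescribed-time controller (PTC), given for $t\in[0,\tau)$ by $$h(\dot q,q,t)=\dot\kappa^2(t)\, f\!\left(\dot q/\dot\kappa(t),q\right)+\frac{\ddot\kappa(t)}{\dot\kappa(t)}M(q)\dot q+\left[1-\dot\kappa^2(t)\right]g(q)$$ and by $h(\dot q,q,t)=f(\dot q,q)$ for $t\in[\tau,\infty)$. Then an output $V(\dot q,q,\mu):=W(\dot q/\dot\kappa(\mu),q,\kappa(\mu))$ of the system under the PTC $u=h(\dot q,q,t)$ at time $\mu\in[0,\tau)$ is equal to the output $W(\dot q,q,t)=V(\dot q/\dot\mu(t),q,\mu(t))$ of the same system (with the same initial conditions) under the ITC $u=f(\dot q,q)$ at time $t=\kappa(\mu)$. Moreover, the equality also holds for the sign (componentwise) of their derivatives with respect to their own time scales: the sign of $dV/d\mu$ along the PTC response at time $\mu$ equals the sign of $dW/dt$ along the ITC response at time $t=\kappa(\mu)$.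
   Context: System: $q\in\mathbb R^n$, $u\in\mathbb R^n$; $M(q)$ is an $n\times n$ positive-definite matrix, $C(\dot q,q)$ is an $n\times n$ matrix linear in $\dot q$, $\dot M(q)-2C(\dot q,q)$ is skew-symmetric, and $g:\mathbb R^n\to\mathbb R^n$. The closed loop under $u=f(\dot q,q)$ is assumed to have a unique solution on $[0,\infty)$ for every initial condition. Function classes (derivatives are assumed to exist where they appear): $\mathcal K(\tau)$ is the set of continuous strictly increasing $\kappa:[0,\tau)\to[0,\infty)$ with $\lim_{t\to0^+}\kappa(t)=0$, $\lim_{t\to\tau^-}\kappa(t)=\infty$. $\mathcal K_1(\tau)$ is the set of $\kappa\in\mathcal K(\tau)$ with $\dot\kappa(0)=1$ and $\ddot\kappa(t)\ge0$ on $[0,\tau)$. $\mathcal M_1(\tau)$ is the set of continuous $\mu:[0,\infty)\to[0,\tau)$ whose inverse belongs to $\mathcal K_1(\tau)$. In "at time $\mu$" the symbol $\mu$ denotes a time in $[0,\tau)$, related to $t\in[0,\infty)$ by $\mu=\mu(t)$, $t=\kappa(\mu)$. In $V(\dot q,q,\mu)$ the arguments $\dot q,q$ are the velocity and position of the PTC response at time $\mu$; in $W(\dot q,q,t)$ they are those of the ITC response at time $t$. *)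

theory Defs
  imports "HOL-Analysis.Analysis"
begin

(* Derivatives are taken relative to the domain S, so at the left endpoint of
   {0..} or {0..<\<tau>} they are one-sided. *)
abbreviation tderiv :: "real set \<Rightarrow> (real \<Rightarrow> 'a::real_normed_vector) \<Rightarrow> real \<Rightarrow> 'a" where
  "tderiv S x t \<equiv> vector_derivative x (at t within S)"

definition class_K :: "real \<Rightarrow> (real \<Rightarrow> real) set" where
  "class_K \<tau> = {\<kappa>. \<kappa> ` {0..<\<tau>} \<subseteq> {0..} \<and> continuous_on {0..<\<tau>} \<kappa> \<and>
     strict_mono_on {0..<\<tau>} \<kappa> \<and>
     (\<kappa> \<longlongrightarrow> 0) (at_right 0) \<and> filterlim \<kappa> at_top (at_left \<tau>)}"

definition class_K1 :: "real \<Rightarrow> (real \<Rightarrow> real) set" where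
  "class_K1 \<tau> = {\<kappa> \<in> class_K \<tau>.
     \<kappa> differentiable_on {0..<\<tau>} \<and>
     tderiv {0..<\<tau>} \<kappa> differentiable_on {0..<\<tau>} \<and>
     tderiv {0..<\<tau>} \<kappa> 0 = 1 \<and>
     (\<forall>t\<in>{0..<\<tau>}. tderiv {0..<\<tau>} (tderiv {0..<\<tau>} \<kappa>) t \<ge> 0)}"

definition inverse_functions :: "'a set \<Rightarrow> 'b set \<Rightarrow> ('a \<Rightarrow> 'b) \<Rightarrow> ('b \<Rightarrow> 'a) \<Rightarrow> bool" where
  "inverse_functions A B f g \<longleftrightarrow>
     f ` A \<subseteq> B \<and> g ` B \<subseteq> A \<and> (\<forall>x\<in>A. g (f x) = x) \<and> (\<forall>y\<in>B. f (g y) = y)"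

definition class_M1 :: "real \<Rightarrow> (real \<Rightarrow> real) set" where
  "class_M1 \<tau> = {\<mu>. \<mu> ` {0..} \<subseteq> {0..<\<tau>} \<and> continuous_on {0..} \<mu> \<and>
     (\<exists>\<kappa>\<in>class_K1 \<tau>. inverse_functions {0..<\<tau>} {0..} \<kappa> \<mu>)}"

(* Symmetry of A is not required. *)
definition pos_def :: "real^'n^'n \<Rightarrow> bool" where
  "pos_def A \<longleftrightarrow> (\<forall>x. x \<noteq> 0 \<longrightarrow> x \<bullet> (A *v x) > 0)"

definition skew_symmetric :: "real^'n^'n \<Rightarrow> bool" where
  "skew_symmetric A \<longleftrightarrow> transpose A = - A"

(* C v q is C(q', q) at velocity v and position q. The time derivative of M(q) along a
   motion passing through q with velocity v is the Frechet derivative of M at q applied to v. *)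
definition mechanical_system ::
  "(real^'n \<Rightarrow> real^'n^'n) \<Rightarrow> (real^'n \<Rightarrow> real^'n \<Rightarrow> real^'n^'n) \<Rightarrow> bool" where
  "mechanical_system M C \<longleftrightarrow>
     (\<forall>q. pos_def (M q)) \<and>
     (\<forall>q. linear (\<lambda>v. C v q)) \<and>
     (\<forall>q. M differentiable (at q)) \<and>
     (\<forall>q v. skew_symmetric (frechet_derivative M (at q) v - 2 *\<^sub>R C v q))"

(* q is, on the time set S (an interval starting at 0), a motion of
   M(q) q'' + C(q', q) q' + g(q) = u(q', q, t) with q(0) = q0 and q'(0) = v0. *)
definition response ::
  "real set \<Rightarrow> (real^'n \<Rightarrow> real^'n^'n) \<Rightarrow> (real^'n \<Rightarrow> real^'n \<Rightarrow> real^'n^'n) \<Rightarrow>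
   (real^'n \<Rightarrow> real^'n) \<Rightarrow> (real^'n \<Rightarrow> real^'n \<Rightarrow> real \<Rightarrow> real^'n) \<Rightarrow>
   real^'n \<Rightarrow> real^'n \<Rightarrow> (real \<Rightarrow> real^'n) \<Rightarrow> bool" where
  "response S M C g u q0 v0 q \<longleftrightarrow>
     q differentiable_on S \<and> tderiv S q differentiable_on S \<and>
     q 0 = q0 \<and> tderiv S q 0 = v0 \<and>
     (\<forall>t\<in>S. M (q t) *v tderiv S (tderiv S q) t + C (tderiv S q t) (q t) *v tderiv S q t + g (q t)
             = u (tderiv S q t) (q t) t)"

definition infinite_time_controller ::
  "(real^'n \<Rightarrow> real^'n^'n) \<Rightarrow> (real^'n \<Rightarrow> real^'n \<Rightarrow> real^'n^'n) \<Rightarrow>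
   (real^'n \<Rightarrow> real^'n) \<Rightarrow> (real^'n \<Rightarrow> real^'n \<Rightarrow> real^'n) \<Rightarrow> bool" where
  "infinite_time_controller M C g f \<longleftrightarrow>
     (\<forall>q0 v0. (\<exists>q. response {0..} M C g (\<lambda>v q t. f v q) q0 v0 q) \<and>
       (\<forall>q q'. response {0..} M C g (\<lambda>v q t. f v q) q0 v0 q \<and>
               response {0..} M C g (\<lambda>v q t. f v q) q0 v0 q' \<longrightarrow> (\<forall>t\<ge>0. q t = q' t)))"

definition prescribed_time_controller ::
  "real \<Rightarrow> (real \<Rightarrow> real) \<Rightarrow> (real^'n \<Rightarrow> real^'n^'n) \<Rightarrow> (real^'n \<Rightarrow> real^'n) \<Rightarrow>
   (real^'n \<Rightarrow> real^'n \<Rightarrow> real^'n) \<Rightarrow> (real^'n \<Rightarrow> real^'n \<Rightarrow> real \<Rightarrow> real^'n)" where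
  "prescribed_time_controller \<tau> \<kappa> M g f v q t =
     (if t < \<tau> then
        (let d\<kappa> = tderiv {0..<\<tau>} \<kappa> t; dd\<kappa> = tderiv {0..<\<tau>} (tderiv {0..<\<tau>} \<kappa>) t in
          d\<kappa>\<^sup>2 *\<^sub>R f (v /\<^sub>R d\<kappa>) q + (dd\<kappa> / d\<kappa>) *\<^sub>R (M q *v v) + (1 - d\<kappa>\<^sup>2) *\<^sub>R g q)
      else f v q)"

end

(* With s in [0,tau) and t = kappa s, the chain rule shows that composing with kappa turns motions
   under f into motions under h, and composing with mu turns motions under h into motions under f.
   By uniqueness under f, every motion under h is therefore qI o kappa, which gives the equality of
   the outputs. The i-th output of the h-motion is thus the i-th output of the f-motion composed
   with kappa, so the two derivatives differ by the factor kappa' s >= 1. *)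
theory Submission
  imports Defs
begin

text \<open>A connected set with two distinct points has no isolated points. Nontriviality of the
  filter is what makes a derivative within \<open>S\<close> unique, so that any derivative found
  there must be the value of \<open>tderiv\<close>.\<close>

lemma at_within_interval_neq_bot:
  fixes S :: "real set"
  assumes "is_interval S" "t \<in> S" "a \<in> S" "b \<in> S" "a \<noteq> b"
  shows "at t within S \<noteq> bot"
proof -
  have "t islimpt S"
    using assms by (intro connected_imp_perfect) (auto simp: is_interval_connected)
  then show ?thesis by (simp add: trivial_limit_within)
qed

lemma tderivI:
  assumes "at t within S \<noteq> bot" "(f has_vector_derivative d) (at t within S)"
  shows "tderiv S f t = d"
  using assms by (rule vector_derivative_within)

lemma differentiable_onD_tderiv:
  assumes "f differentiable_on S" "t \<in> S"
  shows "(f has_vector_derivative tderiv S f t) (at t within S)"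
  using assms by (auto simp: differentiable_on_def vector_derivative_works)

text \<open>Since derivatives within \<open>S\<close> are unique, \<open>tderiv\<close> may be
  replaced by any witnesses for velocity and acceleration. In this form the chain and product rules
  can build new motions from old ones.\<close>

lemma response_iff:
  assumes S: "\<And>t. t \<in> S \<Longrightarrow> at t within S \<noteq> bot" and "0 \<in> S"
  shows "response S M C g u q0 v0 q \<longleftrightarrow>
    (\<exists>v a. (\<forall>t\<in>S. (q has_vector_derivative v t) (at t within S) \<and>
              (v has_vector_derivative a t) (at t within S) \<and>
              M (q t) *v a t + C (v t) (q t) *v v t + g (q t) = u (v t) (q t) t) \<and>
           q 0 = q0 \<and> v 0 = v0)"
    (is "?L \<longleftrightarrow> ?R")
proof
  assume ?L
  then show ?R
    unfolding response_def
    by (intro exI[of _ "tderiv S q"] exI[of _ "tderiv S (tderiv S q)"])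
       (auto intro: differentiable_onD_tderiv)
next
  assume ?R
  then obtain v a where va: "\<And>t. t \<in> S \<Longrightarrow> (q has_vector_derivative v t) (at t within S)"
      "\<And>t. t \<in> S \<Longrightarrow> (v has_vector_derivative a t) (at t within S)"
      "\<And>t. t \<in> S \<Longrightarrow> M (q t) *v a t + C (v t) (q t) *v v t + g (q t) = u (v t) (q t) t"
      "q 0 = q0" "v 0 = v0" by blast
  have v: "tderiv S q t = v t" if "t \<in> S" for t
    using S va(1) that by (simp add: tderivI)
  \<comment> \<open>\<open>tderiv S q\<close> is known to agree with \<open>v\<close> on
    \<open>S\<close> only, which is enough for a derivative taken within \<open>S\<close>.\<close>
  have a: "(tderiv S q has_vector_derivative a t) (at t within S)" if "t \<in> S" for t
    using that v va(2)[OF that] by (rule has_vector_derivative_transform)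
  have "tderiv S (tderiv S q) t = a t" if "t \<in> S" for t
    using S a that by (simp add: tderivI)
  moreover have "q differentiable_on S" "tderiv S q differentiable_on S"
    using va(1) a unfolding differentiable_on_def by (blast intro: differentiableI_vector)+
  ultimately show ?L
    using va v \<open>0 \<in> S\<close> unfolding response_def by simp
qed

lemma vector_diff_chain_into:
  assumes "(\<phi> has_vector_derivative d) (at t within T)" "\<phi> ` T \<subseteq> S"
    and "(q has_vector_derivative v) (at (\<phi> t) within S)"
  shows "((\<lambda>t. q (\<phi> t)) has_vector_derivative d *\<^sub>R v) (at t within T)"
  using vector_diff_chain_within[OF assms(1) has_vector_derivative_within_subset[OF assms(3,2)]]
  by (simp add: o_def)

text \<open>The new motion has velocity \<phi>' v and acceleration \<phi>'^2 a + \<phi>'' v. The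
  left side of the equation without \<open>g\<close> therefore scales by \<phi>'^2 and gains
  \<phi>'' M v, and the condition on \<open>u'\<close> asks for exactly this force. Initial data
  survive because \<phi> 0 = 0 and \<phi>' 0 = 1. The lemma serves for \<kappa> and for its inverse
  \<mu>.\<close>

lemma response_time_change:
  fixes M :: "real^'n \<Rightarrow> real^'n^'n"
  assumes S: "\<And>t. t \<in> S \<Longrightarrow> at t within S \<noteq> bot" "0 \<in> S"
    and T: "\<And>t. t \<in> T \<Longrightarrow> at t within T \<noteq> bot" "0 \<in> T"
    and \<phi>: "\<phi> ` T \<subseteq> S" "\<phi> 0 = 0" "\<phi>' 0 = 1"
      "\<And>t. t \<in> T \<Longrightarrow> (\<phi> has_vector_derivative \<phi>' t) (at t within T)"
      "\<And>t. t \<in> T \<Longrightarrow> (\<phi>' has_vector_derivative \<phi>'' t) (at t within T)"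
    and C: "\<And>q. linear (\<lambda>v. C v q)"
    and u': "\<And>t v q. t \<in> T \<Longrightarrow> u' (\<phi>' t *\<^sub>R v) q t =
      (\<phi>' t)\<^sup>2 *\<^sub>R (u v q (\<phi> t) - g q) + \<phi>'' t *\<^sub>R (M q *v v) + g q"
    and q: "response S M C g u q0 v0 q"
  shows "response T M C g u' q0 v0 (\<lambda>t. q (\<phi> t))"
    and "\<And>t. t \<in> T \<Longrightarrow> tderiv T (\<lambda>t. q (\<phi> t)) t = \<phi>' t *\<^sub>R tderiv S q (\<phi> t)"
proof -
  obtain v a where va: "\<And>t. t \<in> S \<Longrightarrow> (q has_vector_derivative v t) (at t within S)"
      "\<And>t. t \<in> S \<Longrightarrow> (v has_vector_derivative a t) (at t within S)"
      "\<And>t. t \<in> S \<Longrightarrow> M (q t) *v a t + C (v t) (q t) *v v t + g (q t) = u (v t) (q t) t"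
      "q 0 = q0" "v 0 = v0"
    using response_iff[THEN iffD1, OF S q] by blast
  let ?v = "\<lambda>t. \<phi>' t *\<^sub>R v (\<phi> t)" and ?a = "\<lambda>t. \<phi>' t *\<^sub>R \<phi>' t *\<^sub>R a (\<phi> t) + \<phi>'' t *\<^sub>R v (\<phi> t)"
  have dq: "((\<lambda>t. q (\<phi> t)) has_vector_derivative ?v t) (at t within T)" if "t \<in> T" for t
    using that \<phi> va(1) by (intro vector_diff_chain_into) auto
  have dv: "(?v has_vector_derivative ?a t) (at t within T)" if "t \<in> T" for t
    using that \<phi> va(2)
    by (intro has_vector_derivative_scaleR vector_diff_chain_into)
       (auto simp: has_real_derivative_iff_has_vector_derivative)
  have eq: "M (q (\<phi> t)) *v ?a t + C (?v t) (q (\<phi> t)) *v ?v t + g (q (\<phi> t)) = u' (?v t) (q (\<phi> t)) t"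
    if t: "t \<in> T" for t
  proof -
    let ?q = "q (\<phi> t)" and ?w = "v (\<phi> t)" and ?b = "a (\<phi> t)"
    \<comment> \<open>One factor \<phi>' comes from linearity of \<open>C\<close> in the velocity
      and a second from the velocity it multiplies, so this term scales by \<phi>'^2 just as the
      acceleration part of the inertia term does.\<close>
    have "C (\<phi>' t *\<^sub>R ?w) ?q = \<phi>' t *\<^sub>R C ?w ?q"
      by (rule linear_scale[OF C])
    then have "M ?q *v ?a t + C (?v t) ?q *v ?v t =
        (\<phi>' t)\<^sup>2 *\<^sub>R (M ?q *v ?b + C ?w ?q *v ?w) + \<phi>'' t *\<^sub>R (M ?q *v ?w)"
      by (simp add: matrix_vector_mult_scaleR matrix_vector_right_distrib power2_eq_square
          scaleR_add_right flip: scaleR_matrix_vector_assoc)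
    also have "M ?q *v ?b + C ?w ?q *v ?w = u ?w ?q (\<phi> t) - g ?q"
      using va(3)[of "\<phi> t"] t \<phi>(1) by (auto simp: algebra_simps)
    finally show ?thesis
      by (simp add: u'[OF t])
  qed
  show "response T M C g u' q0 v0 (\<lambda>t. q (\<phi> t))"
    using dq dv eq \<phi>(2,3) va(4,5)
    by (intro response_iff[THEN iffD2, OF T] exI[of _ ?v] exI[of _ ?a]) auto
  show "tderiv T (\<lambda>t. q (\<phi> t)) t = \<phi>' t *\<^sub>R tderiv S q (\<phi> t)" if "t \<in> T" for t
  proof -
    have "\<phi> t \<in> S" using \<phi>(1) that by auto
    then have "tderiv S q (\<phi> t) = v (\<phi> t)"
      using S(1) va(1) by (intro tderivI) auto
    then show ?thesis
      using tderivI[OF T(1) dq] that by simp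
  qed
qed

text \<open>The class prescribes only the right limit at 0, and continuity turns it into the value
  there. The bound \<kappa>' \<ge> 1 follows from \<kappa>' 0 = 1 and \<kappa>'' \<ge> 0 by the mean
  value theorem; it later allows division by \<kappa>' and preserves signs.\<close>

lemma class_K1D:
  assumes "\<tau> > 0" "\<kappa> \<in> class_K1 \<tau>"
  shows "\<kappa> 0 = 0"
    and "t \<in> {0..<\<tau>} \<Longrightarrow> (\<kappa> has_vector_derivative tderiv {0..<\<tau>} \<kappa> t) (at t within {0..<\<tau>})"
    and "t \<in> {0..<\<tau>} \<Longrightarrow> (tderiv {0..<\<tau>} \<kappa> has_vector_derivative
      tderiv {0..<\<tau>} (tderiv {0..<\<tau>} \<kappa>) t) (at t within {0..<\<tau>})"
    and "tderiv {0..<\<tau>} \<kappa> 0 = 1"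
    and "t \<in> {0..<\<tau>} \<Longrightarrow> tderiv {0..<\<tau>} \<kappa> t \<ge> 1"
proof -
  let ?d = "tderiv {0..<\<tau>} \<kappa>" and ?dd = "tderiv {0..<\<tau>} (tderiv {0..<\<tau>} \<kappa>)"
  have K: "continuous_on {0..<\<tau>} \<kappa>" "(\<kappa> \<longlongrightarrow> 0) (at_right 0)"
      "\<kappa> differentiable_on {0..<\<tau>}" "?d differentiable_on {0..<\<tau>}" "?d 0 = 1"
      "\<And>t. t \<in> {0..<\<tau>} \<Longrightarrow> ?dd t \<ge> 0"
    using assms(2) by (auto simp: class_K1_def class_K_def)
  have "(\<kappa> \<longlongrightarrow> \<kappa> 0) (at_right 0)"
  proof -
    have "(\<kappa> \<longlongrightarrow> \<kappa> 0) (at 0 within {0..<\<tau>})"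
      using K(1) assms(1) by (auto simp: continuous_on)
    moreover have "at 0 within {0..<\<tau>} = at_right 0"
      using assms(1) by (intro at_within_nhd[of _ "{..<\<tau>}"]) auto
    ultimately show ?thesis by simp
  qed
  then show "\<kappa> 0 = 0"
    using K(2) by (rule tendsto_unique[rotated]) simp
  show "(\<kappa> has_vector_derivative ?d t) (at t within {0..<\<tau>})" if "t \<in> {0..<\<tau>}"
    using K(3) that by (rule differentiable_onD_tderiv)
  have dd: "(?d has_vector_derivative ?dd t) (at t within {0..<\<tau>})" if "t \<in> {0..<\<tau>}" for t
    using K(4) that by (rule differentiable_onD_tderiv)
  then show "t \<in> {0..<\<tau>} \<Longrightarrow> (?d has_vector_derivative ?dd t) (at t within {0..<\<tau>})" .
  show "?d 0 = 1" by (rule K(5))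
  show "?d t \<ge> 1" if t: "t \<in> {0..<\<tau>}"
  proof -
    have "(?d has_derivative (\<lambda>y. y *\<^sub>R ?dd x)) (at x within {0..t})" if "0 \<le> x" "x \<le> t" for x
      unfolding has_vector_derivative_def[symmetric]
      using that t by (intro has_vector_derivative_within_subset[OF dd]) auto
    \<comment> \<open>This weak mean value theorem puts \<open>x\<close> in the closed interval, so
      it also covers the degenerate case t = 0.\<close>
    then have "\<exists>x\<in>{0..t}. ?d t - ?d 0 = (t - 0) *\<^sub>R ?dd x"
      using t by (intro mvt_very_simple) auto
    then obtain x where x: "x \<in> {0..t}" "?d t - ?d 0 = t * ?dd x" by auto
    moreover have "t * ?dd x \<ge> 0"
      using t x(1) K(6)[of x] by simp
    ultimately show ?thesis using K(5) by simp
  qed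
qed

text \<open>The inverse function rule relative to sets: \<open>B\<close> is the image of
  \<open>A\<close> under \<kappa>, so one-sided derivatives at an endpoint are included.\<close>

lemma has_vector_derivative_inverse_functions:
  fixes \<kappa> \<mu> :: "real \<Rightarrow> real"
  assumes inv: "inverse_functions A B \<kappa> \<mu>" and cont: "continuous_on B \<mu>"
    and t: "t \<in> B" and d: "(\<kappa> has_vector_derivative d) (at (\<mu> t) within A)" "d \<noteq> 0"
  shows "(\<mu> has_vector_derivative inverse d) (at t within B)"
proof -
  have AB: "\<kappa> ` A = B" "\<mu> t \<in> A" "\<kappa> (\<mu> t) = t" "\<And>x. x \<in> A \<Longrightarrow> \<mu> (\<kappa> x) = x"
    using inv t unfolding inverse_functions_def by (force simp: image_def)+
  have "(\<mu> has_derivative (\<lambda>x. x *\<^sub>R inverse d)) (at (\<kappa> (\<mu> t)) within \<kappa> ` A)"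
  proof (rule has_derivative_inverse_within)
    show "(\<kappa> has_derivative (\<lambda>x. x *\<^sub>R d)) (at (\<mu> t) within A)"
      using d(1) by (simp add: has_vector_derivative_def)
    show "continuous (at (\<kappa> (\<mu> t)) within \<kappa> ` A) \<mu>"
      using cont t AB by (simp add: continuous_on_eq_continuous_within)
    show "linear (\<lambda>x. x *\<^sub>R inverse d)"
      by (intro linearI) (auto simp: algebra_simps)
    show "(\<lambda>x. x *\<^sub>R inverse d) \<circ> (\<lambda>x. x *\<^sub>R d) = id"
      using d(2) by auto
  qed (use AB in auto)
  then show ?thesis
    by (simp add: AB has_vector_derivative_def)
qed

theorem theorem2:
  fixes \<tau> :: real
    and M :: "real^'n \<Rightarrow> real^'n^'n" and C :: "real^'n \<Rightarrow> real^'n \<Rightarrow> real^'n^'n"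
    and g :: "real^'n \<Rightarrow> real^'n" and f :: "real^'n \<Rightarrow> real^'n \<Rightarrow> real^'n"
    and h :: "real^'n \<Rightarrow> real^'n \<Rightarrow> real \<Rightarrow> real^'n"
    and \<kappa> \<mu> :: "real \<Rightarrow> real"
    and V W :: "real^'n \<Rightarrow> real^'n \<Rightarrow> real \<Rightarrow> real^'m"
    and q0 v0 :: "real^'n"
    and qI :: "real \<Rightarrow> real^'n"
  assumes "\<tau> > 0"
    and "\<kappa> \<in> class_K1 \<tau>" and "\<mu> \<in> class_M1 \<tau>"
    and "inverse_functions {0..<\<tau>} {0..} \<kappa> \<mu>"
    and "mechanical_system M C"
    and "infinite_time_controller M C g f"
    and "h = prescribed_time_controller \<tau> \<kappa> M g f"
    and "\<And>v q s. s \<in> {0..<\<tau>} \<Longrightarrow> V v q s = W (v /\<^sub>R tderiv {0..<\<tau>} \<kappa> s) q (\<kappa> s)"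
    and "response {0..} M C g (\<lambda>v q t. f v q) q0 v0 qI"
  shows "(\<exists>qP. response {0..<\<tau>} M C g h q0 v0 qP) \<and>
    (\<forall>qP. response {0..<\<tau>} M C g h q0 v0 qP \<longrightarrow>
      (\<forall>s\<in>{0..<\<tau>}. \<forall>t. t = \<kappa> s \<longrightarrow>
        V (tderiv {0..<\<tau>} qP s) (qP s) s = W (tderiv {0..} qI t) (qI t) t \<and>
        W (tderiv {0..} qI t) (qI t) t
          = V (tderiv {0..} qI t /\<^sub>R tderiv {0..} \<mu> t) (qI t) (\<mu> t) \<and>
        (\<forall>i D E.
          ((\<lambda>r. V (tderiv {0..<\<tau>} qP r) (qP r) r $ i) has_real_derivative D)
            (at s within {0..<\<tau>}) \<and>
          ((\<lambda>r. W (tderiv {0..} qI r) (qI r) r $ i) has_real_derivative E)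
            (at t within {0..})
          \<longrightarrow> sgn D = sgn E)))"
proof -
  let ?I = "{0..<\<tau>}" and ?J = "{0::real..}"
  define d where "d s = tderiv ?I \<kappa> s" for s
  define dd where "dd s = tderiv ?I d s" for s
  note K1 = class_K1D[OF assms(1,2), folded d_def, folded dd_def]
  have I: "at t within ?I \<noteq> bot" if "t \<in> ?I" for t
    using that \<open>\<tau> > 0\<close>
    by (intro at_within_interval_neq_bot[of _ _ 0 "\<tau> / 2"]) (auto simp: is_interval_1)
  have J: "at t within ?J \<noteq> bot" if "t \<in> ?J" for t
    using that by (intro at_within_interval_neq_bot[of _ _ 0 1]) (auto simp: is_interval_1)
  have zI: "0 \<in> ?I" and zJ: "0 \<in> ?J" using \<open>\<tau> > 0\<close> by auto
  have inv: "\<kappa> ` ?I \<subseteq> ?J" "\<mu> ` ?J \<subseteq> ?I"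
      "\<And>s. s \<in> ?I \<Longrightarrow> \<mu> (\<kappa> s) = s" "\<And>t. t \<in> ?J \<Longrightarrow> \<kappa> (\<mu> t) = t"
    using assms(4) unfolding inverse_functions_def by blast+
  have \<mu>I: "\<mu> t \<in> ?I" if "t \<in> ?J" for t using inv(2) that by blast
  have \<kappa>J: "\<kappa> s \<in> ?J" if "s \<in> ?I" for s using inv(1) that by blast
  have d0: "d s \<noteq> 0" if "s \<in> ?I" for s using K1(5)[OF that] by simp
  have C: "linear (\<lambda>v. C v q)" for q
    using assms(5) by (simp add: mechanical_system_def)
  have h: "h v q s = (d s)\<^sup>2 *\<^sub>R f (v /\<^sub>R d s) q + (dd s / d s) *\<^sub>R (M q *v v) + (1 - (d s)\<^sup>2) *\<^sub>R g q"
    if "s \<in> ?I" for v q s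
    using that by (simp add: assms(7) prescribed_time_controller_def Let_def flip: d_def dd_def)
  \<comment> \<open>The candidates for \<mu>' and \<mu>'': the reciprocal of \<kappa>' at \<mu> t,
    and what differentiating that reciprocal gives, namely -\<kappa>'' / \<kappa>'^3 at \<mu>
    t.\<close>
  define d\<mu> where "d\<mu> t = inverse (d (\<mu> t))" for t
  define dd\<mu> where "dd\<mu> t = - (inverse (d (\<mu> t)) ^ 3 * dd (\<mu> t))" for t
  have \<mu>': "(\<mu> has_vector_derivative d\<mu> t) (at t within ?J)" if t: "t \<in> ?J" for t
    unfolding d\<mu>_def using assms(3)
    by (intro has_vector_derivative_inverse_functions[OF assms(4)] t K1(2) d0 \<mu>I)
       (simp add: class_M1_def)
  have \<mu>'': "(d\<mu> has_vector_derivative dd\<mu> t) (at t within ?J)" if t: "t \<in> ?J" for t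
  proof -
    have "((\<lambda>t. d (\<mu> t)) has_vector_derivative d\<mu> t *\<^sub>R dd (\<mu> t)) (at t within ?J)"
      using \<mu>'[OF t] inv(2) K1(3)[OF \<mu>I[OF t]] by (rule vector_diff_chain_into)
    then have "((\<lambda>t. inverse (d (\<mu> t))) has_real_derivative dd\<mu> t) (at t within ?J)"
      unfolding has_real_derivative_iff_has_vector_derivative[symmetric]
      using d0[OF \<mu>I[OF t]]
      by (auto intro!: derivative_eq_intros simp: d\<mu>_def dd\<mu>_def power3_eq_cube)
    then show ?thesis
      by (simp add: d\<mu>_def[abs_def] has_real_derivative_iff_has_vector_derivative)
  qed
  have \<mu>0: "\<mu> 0 = 0" using inv(3)[OF zI] by (simp add: K1(1))

  \<comment> \<open>The force condition of \<open>response_time_change\<close> for \<phi> =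
    \<kappa>, leading from \<open>f\<close> to \<open>h\<close>. Evaluating \<open>h\<close> at the
    scaled velocity undoes the division inside \<open>f\<close> and cancels the denominator of
    \<kappa>'' / \<kappa>'.\<close>
  have PTC: "h (d s *\<^sub>R v) q s = (d s)\<^sup>2 *\<^sub>R (f v q - g q) + dd s *\<^sub>R (M q *v v) + g q"
    if "s \<in> ?I" for s v q
    using d0[OF that] by (simp add: h[OF that] matrix_vector_mult_scaleR algebra_simps)
  \<comment> \<open>The same condition for \<phi> = \<mu>, leading back from \<open>h\<close> to
    \<open>f\<close>.\<close>
  have ITC: "f (d\<mu> t *\<^sub>R v) q =
      (d\<mu> t)\<^sup>2 *\<^sub>R (h v q (\<mu> t) - g q) + dd\<mu> t *\<^sub>R (M q *v v) + g q" if "t \<in> ?J" for t v q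
  proof -
    let ?d = "d (\<mu> t)"
    \<comment> \<open>The coefficients of \<open>f\<close>, M v and \<open>g\<close> after
      multiplying \<open>h\<close> by \<mu>'^2. The first leaves \<open>f\<close> alone, the second
      cancels the \<mu>'' term, and the third cancels the remaining multiples of
      \<open>g\<close>.\<close>
    have "(d\<mu> t)\<^sup>2 * ?d\<^sup>2 = 1" "(d\<mu> t)\<^sup>2 * (dd (\<mu> t) / ?d) = - dd\<mu> t"
        "(d\<mu> t)\<^sup>2 * (1 - ?d\<^sup>2) = (d\<mu> t)\<^sup>2 - 1"
      using d0[OF \<mu>I[OF that]]
      by (auto simp: d\<mu>_def dd\<mu>_def field_simps power2_eq_square power3_eq_cube)
    then show ?thesis
      by (simp add: h[OF \<mu>I[OF that]] scaleR_diff_right scaleR_add_right scaleR_diff_left)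
         (simp add: d\<mu>_def)
  qed

  have main: "response ?I M C g h q0 v0 (\<lambda>s. qI (\<kappa> s))"
      "\<And>s. s \<in> ?I \<Longrightarrow> tderiv ?I (\<lambda>s. qI (\<kappa> s)) s = d s *\<^sub>R tderiv ?J qI (\<kappa> s)"
    using response_time_change[OF J zJ I zI inv(1) K1(1,4,2,3) C PTC assms(9)] by auto
  have unique: "qP s = qI (\<kappa> s)" if qP: "response ?I M C g h q0 v0 qP" and s: "s \<in> ?I" for qP s
  proof -
    have "d\<mu> 0 = 1" by (simp add: d\<mu>_def \<mu>0 K1(4))
    \<comment> \<open>Only the closed loop under \<open>f\<close> is assumed to have unique motions,
      so an arbitrary motion under \<open>h\<close> is first carried back to the infinite time scale
      by \<mu>.\<close>
    then have "response ?J M C g (\<lambda>v q t. f v q) q0 v0 (\<lambda>t. qP (\<mu> t))"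
      using qP by (intro response_time_change(1)[OF I zI J zJ inv(2) \<mu>0 _ \<mu>' \<mu>'' C ITC])
    then have "qP (\<mu> t) = qI t" if "t \<ge> 0" for t
      using assms(6,9) that unfolding infinite_time_controller_def by blast
    from this[of "\<kappa> s"] \<kappa>J[OF s] inv(3)[OF s] show ?thesis by simp
  qed
  have "V (tderiv ?I qP s) (qP s) s = W (tderiv ?J qI t) (qI t) t \<and>
        W (tderiv ?J qI t) (qI t) t = V (tderiv ?J qI t /\<^sub>R tderiv ?J \<mu> t) (qI t) (\<mu> t) \<and>
        (\<forall>i D E.
          ((\<lambda>r. V (tderiv ?I qP r) (qP r) r $ i) has_real_derivative D) (at s within ?I) \<and>
          ((\<lambda>r. W (tderiv ?J qI r) (qI r) r $ i) has_real_derivative E) (at t within ?J)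
          \<longrightarrow> sgn D = sgn E)"
    if qP: "response ?I M C g h q0 v0 qP" and s: "s \<in> ?I" and t: "t = \<kappa> s" for qP s t
  proof (intro conjI allI impI)
    \<comment> \<open>\<open>unique\<close> equates the two motions on the interval only; both
      velocities are taken within it, so they agree as well.\<close>
    have dqP: "tderiv ?I qP r = d r *\<^sub>R tderiv ?J qI (\<kappa> r)" if r: "r \<in> ?I" for r
    proof -
      have "(qP has_vector_derivative tderiv ?I qP r) (at r within ?I)"
        using qP r by (intro differentiable_onD_tderiv) (auto simp: response_def)
      then have "((\<lambda>s. qI (\<kappa> s)) has_vector_derivative tderiv ?I qP r) (at r within ?I)"
        using has_vector_derivative_transform[OF r] unique[OF qP] by metis
      then show ?thesis
        using tderivI[OF I[OF r]] main(2)[OF r] by metis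
    qed
    have VW: "V (tderiv ?I qP r) (qP r) r = W (tderiv ?J qI (\<kappa> r)) (qI (\<kappa> r)) (\<kappa> r)"
      if r: "r \<in> ?I" for r
      using d0[OF r] by (simp add: assms(8)[OF r, folded d_def] dqP[OF r] unique[OF qP r])
    show "V (tderiv ?I qP s) (qP s) s = W (tderiv ?J qI t) (qI t) t"
      using VW[OF s] t by simp
    \<comment> \<open>Dividing by \<mu>' t multiplies the velocity by \<kappa>' s, which the
      division by \<kappa>' s inside \<open>V\<close> then removes.\<close>
    have "tderiv ?J \<mu> t = inverse (d s)"
      using tderivI[OF J \<mu>'] \<kappa>J[OF s] inv(3)[OF s] t by (simp add: d\<mu>_def)
    then show "W (tderiv ?J qI t) (qI t) t = V (tderiv ?J qI t /\<^sub>R tderiv ?J \<mu> t) (qI t) (\<mu> t)"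
      using t inv(3)[OF s] d0[OF s] by (simp add: assms(8)[OF s, folded d_def])
    fix i D E
    assume "((\<lambda>r. V (tderiv ?I qP r) (qP r) r $ i) has_real_derivative D) (at s within ?I) \<and>
      ((\<lambda>r. W (tderiv ?J qI r) (qI r) r $ i) has_real_derivative E) (at t within ?J)"
    then have D: "((\<lambda>r. V (tderiv ?I qP r) (qP r) r $ i) has_vector_derivative D) (at s within ?I)"
      and E: "((\<lambda>r. W (tderiv ?J qI r) (qI r) r $ i) has_vector_derivative E) (at (\<kappa> s) within ?J)"
      by (auto simp: t has_real_derivative_iff_has_vector_derivative)
    have "((\<lambda>r. W (tderiv ?J qI (\<kappa> r)) (qI (\<kappa> r)) (\<kappa> r) $ i) has_vector_derivative d s *\<^sub>R E)
        (at s within ?I)"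
      by (rule vector_diff_chain_into[OF K1(2)[OF s] inv(1) E])
    \<comment> \<open>\<open>VW\<close> holds at every point of the interval and not just at
      \<open>s\<close>, so the derivative transfers from the composed \<open>W\<close> output to the
      \<open>V\<close> output.\<close>
    then have "((\<lambda>r. V (tderiv ?I qP r) (qP r) r $ i) has_vector_derivative d s *\<^sub>R E) (at s within ?I)"
      by (rule has_vector_derivative_transform[OF s, rotated]) (simp add: VW)
    then have "D = d s * E"
      using vector_derivative_unique_within[OF I[OF s] D] by simp
    then show "sgn D = sgn E"
      using K1(5)[OF s] by (simp add: sgn_mult)
  qed
  then show ?thesis using main(1) by blast
qed

end
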